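(* Let $B$ be a complete Boolean algebra satisfying the $(2^{\aleph_0})^+$-chain condition. If player II has a winning strategy in the cut and choose game $\mathcal G_{c\&c}$ on $B$, then player II has a winning strategy in the descending chain game $\mathcal G$ on $B$.
   Context: The cut and choose game $\mathcal G_{c\&c}$ on a complete Boolean algebra $B$: player I first plays a nonzero $p\in B$ together with $b_0\in B$; II answers $r_0\in\{0,1\}$; then I plays $b_1\in B$, II answers $r_1\in\{0,1\}$, and so on for $\omega$ moves. II wins the run if $p\wedge\bigwedge_{i<\omega,\ r_i=1} b_i-\bigvee_{i<\omega,\ r_i=0} b_i\neq 0$. The descending chain game $\mathcal G$ on $B$: players I and II alternately play nonzero elements $b_0\ge c_0\ge b_1\ge c_1\ge\cdots$ of $B$ (I plays the $b_i$, II plays the $c_i$); II wins the run if $\bigwedge_{i<\omega} b_i\neq 0$. The $(2^{\aleph_0})^+$-chain condition means every antichain of $B$ has cardinality at most $2^{\aleph_0}$. *)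

theory Defs
  imports Complex_Main "HOL-Library.Equipollence"
begin

text \<open>
  A complete Boolean algebra is a type of sort
  \<open>{boolean_algebra, complete_lattice}\<close>. The library class
  \<open>complete_boolean_algebra\<close> is unsuitable: it extends
  \<open>complete_distrib_lattice\<close>, hence demands complete distributivity, and so
  covers only the atomic complete Boolean algebras.
\<close>

text \<open>Antichains in the Boolean algebra sense: nonzero and pairwise disjoint elements.\<close>

definition antichain :: "'a::boolean_algebra set \<Rightarrow> bool"
  where "antichain A \<longleftrightarrow> bot \<notin> A \<and> pairwise (\<lambda>x y. inf x y = bot) A"

text \<open>The \<open>(2\<^sup>\<aleph>\<^sup>0)\<^sup>+\<close>-chain condition.\<close>

definition continuum_plus_cc :: "'a::boolean_algebra itself \<Rightarrow> bool"
  where "continuum_plus_cc _ \<longleftrightarrow>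
    (\<forall>A :: 'a set. antichain A \<longrightarrow> A \<lesssim> (UNIV :: nat set set))"

text \<open>
  A strategy for player II maps the moves made so far by player I to the next
  move of player II; the earlier moves of II are determined by these. Against
  the moves \<open>b\<close> of I, the list \<open>map b [0..<Suc n]\<close> consists of
  \<open>b 0, \<dots>, b n\<close>.
\<close>

text \<open>
  Cut and choose game: the first argument of a strategy is the initial element
  \<open>p\<close>, and \<open>True\<close> and \<open>False\<close> stand for the answers 1 and 0.
\<close>

definition cut_choose_payoff ::
  "'a::{boolean_algebra,complete_lattice} \<Rightarrow> (nat \<Rightarrow> 'a) \<Rightarrow> (nat \<Rightarrow> bool) \<Rightarrow> 'a"
  where "cut_choose_payoff p b r = inf p (INF i\<in>{i. r i}. b i) - (SUP i\<in>{i. \<not> r i}. b i)"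

definition cut_choose_winning_II ::
  "('a::{boolean_algebra,complete_lattice} \<Rightarrow> 'a list \<Rightarrow> bool) \<Rightarrow> bool"
  where "cut_choose_winning_II \<sigma> \<longleftrightarrow>
    (\<forall>p b r. p \<noteq> bot \<longrightarrow> (\<forall>n. r n = \<sigma> p (map b [0..<Suc n])) \<longrightarrow>
      cut_choose_payoff p b r \<noteq> bot)"

text \<open>
  Descending chain game: \<open>chain_legal_I b c n\<close> says that the moves
  \<open>b 0, \<dots>, b n\<close> of I obey the rules when II has answered
  \<open>c 0, \<dots>, c (n - 1)\<close>.
\<close>

definition chain_legal_I ::
  "(nat \<Rightarrow> 'a::{boolean_algebra,complete_lattice}) \<Rightarrow> (nat \<Rightarrow> 'a) \<Rightarrow> nat \<Rightarrow> bool"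
  where "chain_legal_I b c n \<longleftrightarrow> (\<forall>i\<le>n. b i \<noteq> bot) \<and> (\<forall>i<n. b (Suc i) \<le> c i)"

text \<open>
  The first conjunct of the conclusion makes II answer legally at every
  position that is reached by legal moves of I, also in runs in which I breaks
  the rules later.
\<close>

definition chain_winning_II ::
  "('a::{boolean_algebra,complete_lattice} list \<Rightarrow> 'a) \<Rightarrow> bool"
  where "chain_winning_II \<tau> \<longleftrightarrow>
    (\<forall>b c. (\<forall>n. c n = \<tau> (map b [0..<Suc n])) \<longrightarrow>
      (\<forall>n. chain_legal_I b c n \<longrightarrow> c n \<noteq> bot \<and> c n \<le> b n) \<and>
      ((\<forall>n. chain_legal_I b c n) \<longrightarrow> (INF n. b n) \<noteq> bot))"

end

theory Submission
  imports Defs "HOL-Library.Nat_Bijection"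
begin

text \<open>
  By the chain condition a maximal antichain can be indexed by sets of naturals, so I can feed it
  bit by bit to the cut and choose strategy \<open>\<sigma>\<close> of II; the result of a complete run lies below a
  single member of every antichain fed in this way. Consider the auxiliary game in which II
  supplements her moves in the descending chain game by such antichains, of which her next move
  respects one member below the last move of I, while she stays below the remainder of the run
  against \<open>\<sigma>\<close> in which the bits of all antichains are played in turn. This game is closed for II,
  and surviving in it wins the descending chain game. If I could beat every answer to his first
  move \<open>p\<close>, then, at each stage, his replies to all possible answers of II would be dense below the
  current remainder. A maximal antichain of such replies is itself a legal move of II; feeding
  these antichains to \<open>\<sigma>\<close>, the result of the run singles out an infinite run of the auxiliary
  game against a well-founded strategy of I, a contradiction.
\<close>

section \<open>Maximal antichains and their indexing\<close>

text \<open>Take a maximal antichain contained in \<open>H\<close>. If part of \<open>u\<close> lay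
  outside its supremum, density would give a member of \<open>H\<close> there to enlarge it.\<close>

lemma antichain_below_dense:
  fixes u :: "'a::{boolean_algebra,complete_lattice}"
  assumes dense: "\<And>c. c \<noteq> bot \<Longrightarrow> c \<le> u \<Longrightarrow> \<exists>h\<in>H. h \<noteq> bot \<and> h \<le> c"
  obtains A where "A \<subseteq> H" "antichain A" "u \<le> Sup A"
proof -
  let ?F = "{A. A \<subseteq> H \<and> antichain A}"
  have "\<exists>M\<in>?F. \<forall>X\<in>?F. M \<subseteq> X \<longrightarrow> X = M"
  proof (rule subset_Zorn')
    fix C assume C: "subset.chain ?F C"
    have "inf x y = bot" if XY: "X \<in> C" "Y \<in> C" "x \<in> X" "y \<in> Y" "x \<noteq> y" for X Y x y
    proof -
      have "X \<subseteq> Y \<or> Y \<subseteq> X" using C XY by (auto simp: subset_chain_def)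
      then obtain Z where "Z \<in> C" "x \<in> Z" "y \<in> Z" using XY by blast
      then have "antichain Z" using C by (auto simp: subset_chain_def)
      then show ?thesis using \<open>x \<in> Z\<close> \<open>y \<in> Z\<close> \<open>x \<noteq> y\<close>
        by (auto simp: antichain_def pairwise_def)
    qed
    moreover have "\<Union>C \<subseteq> H" "bot \<notin> \<Union>C" using C by (auto simp: subset_chain_def antichain_def)
    ultimately show "\<Union>C \<in> ?F" by (auto simp: antichain_def pairwise_def)
  qed
  then obtain M where "M \<in> ?F" and max: "\<forall>X\<in>?F. M \<subseteq> X \<longrightarrow> X = M" by (rule bexE)
  then have M: "M \<subseteq> H" "antichain M" by simp_all
  have "u \<le> Sup M"
  proof (rule ccontr)
    assume "\<not> u \<le> Sup M"
    then have "inf u (- Sup M) \<noteq> bot" by (simp add: inf_shunt)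
    then obtain h where h: "h \<in> H" "h \<noteq> bot" "h \<le> inf u (- Sup M)"
      using dense[of "inf u (- Sup M)"] by auto
    have disj: "inf h m = bot" if "m \<in> M" for m
    proof -
      have "m \<le> Sup M" using that by (rule Sup_upper)
      then have "h \<le> - m" using h(3) by (meson compl_mono le_infE order_trans)
      then show ?thesis by (simp add: inf_shunt)
    qed
    then have "antichain (insert h M)"
      using M h by (auto simp: antichain_def pairwise_insert inf.commute)
    then have "h \<in> M" using max M h by blast
    then show False using disj[of h] h by simp
  qed
  then show ?thesis using that M by blast
qed

definition disjoint_parts :: "('i \<Rightarrow> 'a::boolean_algebra) \<Rightarrow> bool"
  where "disjoint_parts y \<longleftrightarrow> (\<forall>x x'. x \<noteq> x' \<longrightarrow> inf (y x) (y x') = bot)"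

lemma antichain_as_parts:
  fixes A :: "'a::{boolean_algebra,complete_lattice} set"
  assumes "continuum_plus_cc TYPE('a)" "antichain A"
  obtains y :: "nat set \<Rightarrow> 'a"
  where "disjoint_parts y" "(SUP x. y x) = Sup A" "\<And>x. y x \<noteq> bot \<Longrightarrow> y x \<in> A"
proof -
  obtain f :: "'a \<Rightarrow> nat set" where f: "inj_on f A"
    using assms unfolding continuum_plus_cc_def lepoll_def by blast
  define y where "y x = (if x \<in> f ` A then inv_into A f x else bot)" for x
  have in_A: "y x \<in> A" if "y x \<noteq> bot" for x
    using that by (auto simp: y_def inv_into_into split: if_splits)
  have y_f: "y (f a) = a" if "a \<in> A" for a using that f by (simp add: y_def)
  have "inf (y x) (y x') = bot" if "x \<noteq> x'" for x x'
  proof (cases "x \<in> f ` A \<and> x' \<in> f ` A")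
    case True
    then obtain a a' where "a \<in> A" "a' \<in> A" "x = f a" "x' = f a'" by blast
    then show ?thesis using that y_f assms(2) by (auto simp: antichain_def pairwise_def)
  next
    case False
    then show ?thesis by (auto simp: y_def)
  qed
  then have "disjoint_parts y" by (simp add: disjoint_parts_def)
  moreover have "(SUP x. y x) = Sup A"
  proof (rule antisym)
    show "(SUP x. y x) \<le> Sup A"
      using in_A by (metis (no_types, lifting) SUP_least Sup_upper bot_least)
    show "Sup A \<le> (SUP x. y x)"
      using y_f by (metis Sup_least SUP_upper UNIV_I)
  qed
  ultimately show ?thesis using that in_A by blast
qed

text \<open>Only complements are needed: if \<open>c\<close> were disjoint from all parts,
  \<open>- c\<close> would bound their supremum and hence \<open>c\<close> itself.\<close>

lemma meets_part:
  fixes c :: "'a::{boolean_algebra,complete_lattice}"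
  assumes "c \<noteq> bot" "c \<le> (SUP x\<in>X. y x)"
  obtains x where "x \<in> X" "inf c (y x) \<noteq> bot"
proof -
  have False if "\<forall>x\<in>X. inf c (y x) = bot"
  proof -
    have "(SUP x\<in>X. y x) \<le> - c" using that by (intro SUP_least) (metis inf.commute inf_shunt)
    then have "c \<le> - c" using assms(2) by order
    then show False using assms(1) by (metis inf.idem inf_shunt)
  qed
  then show ?thesis using that by blast
qed

section \<open>Well-founded strategies of I\<close>

text \<open>
  Well-founded strategies of I in the auxiliary game: a move together with the continuation for
  each answer of II. No position is won with \<open>Resign\<close>, which only makes the type inhabited.
\<close>

datatype 'a strat = Resign | Move 'a "(nat set \<Rightarrow> 'a) \<Rightarrow> 'a \<Rightarrow> 'a strat"

definition child :: "'a strat \<Rightarrow> 'a strat \<Rightarrow> bool"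
  where "child S' S \<longleftrightarrow> (\<exists>b f y c. S = Move b f \<and> S' = f y c)"

text \<open>Structural induction on the first strategy; the induction hypothesis applies to the
  sequence without its first term.\<close>

lemma no_infinite_descent: "\<not> (\<forall>n. child (S (Suc n)) (S n))"
proof -
  have "S 0 = S0 \<Longrightarrow> \<not> (\<forall>n. child (S (Suc n)) (S n))" for S0
  proof (induction S0 arbitrary: S)
    case Resign
    then show ?case by (metis child_def strat.distinct(1))
  next
    case (Move b f)
    show ?case
    proof
      assume run: "\<forall>n. child (S (Suc n)) (S n)"
      then obtain y c where "S 1 = f y c" using Move.prems unfolding child_def
        by (metis One_nat_def strat.inject)
      then show False using Move.IH[of "f y" "f y c" "\<lambda>n. S (Suc n)"] run by auto
    qed
  qed
  then show ?thesis by simp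
qed

section \<open>Feeding antichains to the cut and choose strategy\<close>

locale cut_choose_strategy =
  fixes \<sigma> :: "'a::{boolean_algebra,complete_lattice} \<Rightarrow> 'a list \<Rightarrow> bool"
  assumes winning: "cut_choose_winning_II \<sigma>"
    and cc: "continuum_plus_cc TYPE('a)"
begin

text \<open>
  Move \<open>m\<close> of I asks for bit \<open>k\<close> of the index into the antichain \<open>Y i\<close>. As \<open>i \<le> m\<close>, the moves up to
  \<open>m\<close> depend on \<open>Y 0, \<dots>, Y m\<close> only.
\<close>

definition cut :: "(nat \<Rightarrow> nat set \<Rightarrow> 'a) \<Rightarrow> nat \<Rightarrow> 'a"
  where "cut Y m = (case prod_decode m of (i, k) \<Rightarrow> SUP x\<in>{x. k \<in> x}. Y i x)"

definition answer :: "'a \<Rightarrow> (nat \<Rightarrow> nat set \<Rightarrow> 'a) \<Rightarrow> nat \<Rightarrow> bool"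
  where "answer p Y m = \<sigma> p (map (cut Y) [0..<Suc m])"

definition piece :: "'a \<Rightarrow> (nat \<Rightarrow> nat set \<Rightarrow> 'a) \<Rightarrow> nat \<Rightarrow> 'a"
  where "piece p Y m = (if answer p Y m then cut Y m else - cut Y m)"

text \<open>There are as many cuts as antichains, so cut \<open>m\<close> looks up only entries of
  index at most \<open>m\<close>, all inside the list.\<close>

definition remainder :: "'a \<Rightarrow> (nat set \<Rightarrow> 'a) list \<Rightarrow> 'a"
  where "remainder p ys = inf p (INF m\<in>{..<length ys}. piece p (nth ys) m)"

lemma cut_cong:
  assumes "\<And>i. i \<le> m \<Longrightarrow> Y i = Y' i"
  shows "cut Y m = cut Y' m"
proof -
  obtain i k where ik: "prod_decode m = (i, k)" by force
  then have "i \<le> m" by (metis le_prod_encode_1 prod_decode_inverse)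
  then show ?thesis using assms ik by (simp add: cut_def)
qed

lemma piece_cong:
  assumes "\<And>i. i \<le> m \<Longrightarrow> Y i = Y' i"
  shows "piece p Y m = piece p Y' m"
proof -
  have "cut Y i = cut Y' i" if "i \<le> m" for i using that assms by (intro cut_cong) auto
  then have "map (cut Y) [0..<Suc m] = map (cut Y') [0..<Suc m]" "cut Y m = cut Y' m" by auto
  then show ?thesis by (simp only: piece_def answer_def)
qed

lemma remainder_map:
  "remainder p (map Y [0..<n]) = inf p (INF m\<in>{..<n}. piece p Y m)"
proof -
  have "piece p (nth (map Y [0..<n])) m = piece p Y m" if "m < n" for m
    using that by (intro piece_cong) auto
  then show ?thesis by (simp add: remainder_def)
qed

lemma remainder_le_piece: "m < n \<Longrightarrow> remainder p (map Y [0..<n]) \<le> piece p Y m"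
  unfolding remainder_map by (meson INF_lower inf.coboundedI2 lessThan_iff)

lemma remainder_snoc_le: "remainder p (ys @ [y]) \<le> remainder p ys"
proof -
  have "piece p (nth (ys @ [y])) m = piece p (nth ys) m" if "m < length ys" for m
    using that by (intro piece_cong) (auto simp: nth_append)
  then have "(INF m\<in>{..<length ys}. piece p (nth (ys @ [y])) m)
      = (INF m\<in>{..<length ys}. piece p (nth ys) m)" by simp
  then show ?thesis unfolding remainder_def
    by (metis INF_superset_mono inf_mono order_refl length_append_singleton lessThan_subset_iff
        le_SucI)
qed

text \<open>By disjointness the cut for bit \<open>k\<close> either contains \<open>Y n x\<close> or
  is disjoint from it, so a nonzero \<open>z\<close> inside both the part and the chosen piece
  forces the answer.\<close>

lemma answer_iff_mem:
  assumes "disjoint_parts (Y n)" "z \<noteq> bot" "z \<le> Y n x" "z \<le> piece p Y (prod_encode (n, k))"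
  shows "answer p Y (prod_encode (n, k)) \<longleftrightarrow> k \<in> x"
proof
  let ?cut = "SUP x\<in>{x. k \<in> x}. Y n x"
  assume "answer p Y (prod_encode (n, k))"
  then have "z \<le> ?cut" using assms(4) by (simp add: piece_def cut_def)
  with \<open>z \<noteq> bot\<close> obtain x' where "k \<in> x'" "inf z (Y n x') \<noteq> bot"
    by (metis (mono_tags, lifting) meets_part mem_Collect_eq)
  moreover have "inf z (Y n x') \<le> inf (Y n x) (Y n x')" using assms(3) by (rule inf_mono) simp
  ultimately show "k \<in> x" using assms(1) by (metis disjoint_parts_def bot_unique)
next
  let ?cut = "SUP x\<in>{x. k \<in> x}. Y n x"
  assume "k \<in> x"
  then have "Y n x \<le> ?cut" by (intro SUP_upper) simp
  then have "z \<le> cut Y (prod_encode (n, k))" using assms(3) by (simp add: cut_def)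
  then show "answer p Y (prod_encode (n, k))"
    using assms(2,4) by (metis piece_def inf_shunt inf.orderE le_inf_iff bot_unique inf_compl_bot)
qed

text \<open>The payoff of the full run lies in every piece. If some of it lay outside the part named
  by the answers, that portion would meet a part by \<open>cover\<close>; the answers then spell out
  the index of this part, so it is the named one after all.\<close>

lemma complete_run:
  assumes p: "p \<noteq> bot"
    and disj: "\<And>n. disjoint_parts (Y n)"
    and cover: "\<And>n. remainder p (map Y [0..<n]) \<le> (SUP x. Y n x)"
  obtains q where "q \<noteq> bot" "\<And>n. q \<le> remainder p (map Y [0..<n])"
    "\<And>n. q \<le> Y n {k. answer p Y (prod_encode (n, k))}"
proof -
  define q where "q = cut_choose_payoff p (cut Y) (answer p Y)"
  have "q \<noteq> bot" using winning p unfolding cut_choose_winning_II_def q_def by (simp add: answer_def)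
  have q_le: "q \<le> inf p (INF i\<in>{i. answer p Y i}. cut Y i)"
    "q \<le> - (SUP i\<in>{i. \<not> answer p Y i}. cut Y i)"
    unfolding q_def cut_choose_payoff_def diff_eq by (rule inf.cobounded1 inf.cobounded2)+
  have q_piece: "q \<le> piece p Y m" for m
  proof (cases "answer p Y m")
    case True
    then have "(INF i\<in>{i. answer p Y i}. cut Y i) \<le> cut Y m" by (intro INF_lower) simp
    then show ?thesis using q_le(1) True by (auto simp: piece_def intro: order_trans)
  next
    case False
    then have "cut Y m \<le> (SUP i\<in>{i. \<not> answer p Y i}. cut Y i)" by (intro SUP_upper) simp
    then show ?thesis using q_le(2) False
      by (auto simp: piece_def intro: order_trans compl_mono)
  qed
  then have q_rem: "q \<le> remainder p (map Y [0..<n])" for n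
    using q_le(1) by (auto simp: remainder_map intro: INF_greatest)
  have "q \<le> Y n {k. answer p Y (prod_encode (n, k))}" (is "_ \<le> Y n ?x") for n
  proof (rule ccontr)
    assume "\<not> q \<le> Y n ?x"
    then have "inf q (- Y n ?x) \<noteq> bot" by (simp add: inf_shunt)
    moreover have "inf q (- Y n ?x) \<le> (SUP x. Y n x)"
      using q_rem[of n] cover[of n] by (meson le_infI1 order_trans)
    ultimately obtain x where x: "inf (inf q (- Y n ?x)) (Y n x) \<noteq> bot"
      by (metis meets_part)
    let ?z = "inf (inf q (- Y n ?x)) (Y n x)"
    have "?z \<le> piece p Y m" for m using q_piece[of m] by (simp add: inf.coboundedI1)
    then have "answer p Y (prod_encode (n, k)) \<longleftrightarrow> k \<in> x" for k
      by (rule answer_iff_mem[of Y n, OF disj x inf.cobounded2])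
    then have "x = ?x" by auto
    then show False using x by (simp add: inf.assoc)
  qed
  then show ?thesis using that \<open>q \<noteq> bot\<close> q_rem by blast
qed

section \<open>The auxiliary game\<close>

text \<open>
  A position of the auxiliary game consists of the first move \<open>p\<close> of I, the antichains \<open>ys\<close> and
  the last move \<open>c\<close> of II. After the next move \<open>b\<close> of I, player II adds an antichain \<open>y\<close> and moves
  to \<open>c\<close>.
\<close>

definition legal :: "'a \<Rightarrow> (nat set \<Rightarrow> 'a) list \<Rightarrow> 'a \<Rightarrow> (nat set \<Rightarrow> 'a) \<Rightarrow> 'a \<Rightarrow> bool"
  where "legal p ys b y c \<longleftrightarrow> disjoint_parts y \<and> remainder p ys \<le> (SUP x. y x) \<and>
    c \<noteq> bot \<and> c \<le> remainder p (ys @ [y]) \<and> (\<exists>x. c \<le> y x \<and> y x \<le> b)"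

primrec beats :: "'a \<Rightarrow> 'a strat \<Rightarrow> (nat set \<Rightarrow> 'a) list \<Rightarrow> 'a \<Rightarrow> bool"
  where
    "beats p Resign = (\<lambda>ys c. False)"
  | "beats p (Move b f) = (\<lambda>ys c. b \<noteq> bot \<and> b \<le> c \<and>
      (\<forall>y c'. legal p ys b y c' \<longrightarrow> beats p (f y c') (ys @ [y]) c'))"

definition survives :: "'a \<Rightarrow> (nat set \<Rightarrow> 'a) list \<Rightarrow> 'a \<Rightarrow> bool"
  where "survives p ys c \<longleftrightarrow> c \<noteq> bot \<and> (\<nexists>S. beats p S ys c)"

text \<open>Otherwise the strategies that beat the single answers to \<open>b\<close>, selected by
  choice, combine into one that opens with \<open>b\<close> and beats the position itself.\<close>

lemma survives_step:
  assumes "survives p ys c" "b \<noteq> bot" "b \<le> c"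
  shows "\<exists>y c'. legal p ys b y c' \<and> survives p (ys @ [y]) c'"
proof (rule ccontr)
  assume "\<not> ?thesis"
  then have "\<forall>y c'. \<exists>S. legal p ys b y c' \<longrightarrow> beats p S (ys @ [y]) c'"
    by (auto simp: survives_def legal_def)
  then obtain f where "\<forall>y c'. legal p ys b y c' \<longrightarrow> beats p (f y c') (ys @ [y]) c'" by metis
  then have "beats p (Move b f) ys c" using assms by simp
  then show False using assms(1) unfolding survives_def by blast
qed

section \<open>Refuting a dense family of beaten positions\<close>

text \<open>
  \<open>R\<close> collects the moves of II, at positions with antichains \<open>ys\<close>, that the simulation takes into
  account, each with a strategy of I that beats it.
\<close>

definition densely_beaten :: "'a \<Rightarrow> (nat set \<Rightarrow> 'a) list \<Rightarrow> ('a \<times> 'a strat) set \<Rightarrow> bool"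
  where "densely_beaten p ys R \<longleftrightarrow> (\<forall>(c, S)\<in>R. beats p S ys c) \<and>
    (\<forall>c. c \<noteq> bot \<longrightarrow> c \<le> remainder p ys \<longrightarrow> (\<exists>c' S. c' \<le> c \<and> (c', S) \<in> R))"

text \<open>Opening moves of strategies in \<open>R\<close> are dense below the remainder, and
  \<open>y\<close> indexes an antichain of them. Each nonzero part \<open>y x\<close> is the opening
  move of \<open>g x\<close>, and \<open>R'\<close> holds the continuations of these strategies
  after II answers with \<open>y\<close>.\<close>

lemma densely_beaten_step:
  assumes "densely_beaten p ys R"
  shows "\<exists>y g R'. disjoint_parts y \<and> remainder p ys \<le> (SUP x. y x) \<and>
    densely_beaten p (ys @ [y]) R' \<and>
    (\<forall>x. y x \<noteq> bot \<longrightarrow> (\<exists>c. y x \<le> c \<and> (c, g x) \<in> R)) \<and>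
    (\<forall>(c, S)\<in>R'. \<exists>x. c \<le> y x \<and> child S (g x))"
proof -
  define H where "H = {b. \<exists>c f. (c, Move b f) \<in> R}"
  have beaten: "beats p S ys c" if "(c, S) \<in> R" for c S
    using assms that by (auto simp: densely_beaten_def)
  have "\<exists>h\<in>H. h \<noteq> bot \<and> h \<le> c" if c: "c \<noteq> bot" "c \<le> remainder p ys" for c
  proof -
    obtain c' S where cS: "c' \<le> c" "(c', S) \<in> R" using assms c by (auto simp: densely_beaten_def)
    then obtain b f where "S = Move b f" using beaten by (cases S) fastforce+
    then have "b \<in> H" "b \<noteq> bot" "b \<le> c'" using cS beaten[OF cS(2)] by (auto simp: H_def)
    then show ?thesis using cS(1) order_trans by blast
  qed
  then obtain A where A: "A \<subseteq> H" "antichain A" "remainder p ys \<le> Sup A"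
    using antichain_below_dense[of "remainder p ys" H] by blast
  obtain y :: "nat set \<Rightarrow> 'a" where y: "disjoint_parts y" "(SUP x. y x) = Sup A"
    "\<And>x. y x \<noteq> bot \<Longrightarrow> y x \<in> A" using antichain_as_parts[OF cc A(2)] by blast
  have "\<exists>S. y x \<noteq> bot \<longrightarrow> (\<exists>c f. (c, S) \<in> R \<and> S = Move (y x) f)" for x
    using y(3)[of x] A(1) unfolding H_def by blast
  then obtain g where g: "\<And>x. y x \<noteq> bot \<Longrightarrow> \<exists>c f. (c, g x) \<in> R \<and> g x = Move (y x) f" by metis
  define R' where "R' = {(c, S). beats p S (ys @ [y]) c \<and> (\<exists>x. c \<le> y x \<and> child S (g x))}"
  have "\<exists>c' S. c' \<le> c \<and> (c', S) \<in> R'"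
    if c: "c \<noteq> bot" "c \<le> remainder p (ys @ [y])" for c
  proof -
    have "c \<le> (SUP x. y x)" using c(2) remainder_snoc_le[of p ys y] A(3) y(2) by simp
    then obtain x where x: "inf c (y x) \<noteq> bot" using c(1) by (metis meets_part)
    then have "y x \<noteq> bot" by auto
    then obtain c0 f where f: "(c0, g x) \<in> R" "g x = Move (y x) f" using g by blast
    \<comment> \<open>The move of I is here the part \<open>y x\<close> itself, so this part
      witnesses the last clause of \<open>legal\<close>.\<close>
    have "legal p ys (y x) y (inf c (y x))"
      using x y A(3) c(2) by (auto simp: legal_def intro: le_infI1 inf.cobounded2)
    then have "beats p (f y (inf c (y x))) (ys @ [y]) (inf c (y x))"
      using beaten[OF f(1)] f(2) by simp
    moreover have "child (f y (inf c (y x))) (g x)" using f(2) by (auto simp: child_def)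
    ultimately have "(inf c (y x), f y (inf c (y x))) \<in> R'" unfolding R'_def by (auto intro: inf.cobounded2)
    then show ?thesis using inf.cobounded1 by blast
  qed
  then have "densely_beaten p (ys @ [y]) R'" by (auto simp: densely_beaten_def R'_def)
  moreover have "\<exists>c. y x \<le> c \<and> (c, g x) \<in> R" if "y x \<noteq> bot" for x
    using g[OF that] beaten by fastforce
  moreover have "\<forall>(c, S)\<in>R'. \<exists>x. c \<le> y x \<and> child S (g x)" by (auto simp: R'_def)
  moreover have "remainder p ys \<le> (SUP x. y x)" using A(3) y(2) by simp
  ultimately show ?thesis using y(1) by blast
qed

lemma not_densely_beaten:
  assumes p: "p \<noteq> bot"
  shows "\<not> densely_beaten p [] R"
proof
  assume R: "densely_beaten p [] R"
  \<comment> \<open>The length clause later identifies the initial list as empty.\<close>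
  define P where "P n st \<longleftrightarrow> (case st of (ys, R) \<Rightarrow> length ys = n \<and> densely_beaten p ys R)"
    for n and st :: "(nat set \<Rightarrow> 'a) list \<times> ('a \<times> 'a strat) set"
  define Q where "Q st st' \<longleftrightarrow> (case (st, st') of ((ys, R), (ys', R')) \<Rightarrow>
    \<exists>y g. ys' = ys @ [y] \<and> disjoint_parts y \<and> remainder p ys \<le> (SUP x. y x) \<and>
    (\<forall>x. y x \<noteq> bot \<longrightarrow> (\<exists>c. y x \<le> c \<and> (c, g x) \<in> R)) \<and>
    (\<forall>(c, S)\<in>R'. \<exists>x. c \<le> y x \<and> child S (g x)))"
    for st st' :: "(nat set \<Rightarrow> 'a) list \<times> ('a \<times> 'a strat) set"
  have "\<exists>st. \<forall>n. P n (st n) \<and> Q (st n) (st (Suc n))"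
  proof (rule dependent_nat_choice)
    show "\<exists>st. P 0 st" using R by (auto simp: P_def)
    fix st n assume "P n st"
    then obtain ys R where st: "st = (ys, R)" "length ys = n" "densely_beaten p ys R"
      by (auto simp: P_def)
    obtain y g R' where "disjoint_parts y \<and> remainder p ys \<le> (SUP x. y x) \<and>
      densely_beaten p (ys @ [y]) R' \<and>
      (\<forall>x. y x \<noteq> bot \<longrightarrow> (\<exists>c. y x \<le> c \<and> (c, g x) \<in> R)) \<and>
      (\<forall>(c, S)\<in>R'. \<exists>x. c \<le> y x \<and> child S (g x))"
      using densely_beaten_step[OF st(3)] by blast
    then have "P (Suc n) (ys @ [y], R') \<and> Q st (ys @ [y], R')"
      unfolding P_def Q_def st(1) using st(2) by auto
    then show "\<exists>st'. P (Suc n) st' \<and> Q st st'" by blast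
  qed
  then obtain st where st: "\<And>n. P n (st n)" "\<And>n. Q (st n) (st (Suc n))" by blast
  define ys where "ys n = fst (st n)" for n
  define R where "R n = snd (st n)" for n
  have len: "length (ys n) = n" for n
    using st(1)[of n] by (auto simp: P_def ys_def split: prod.splits)
  \<comment> \<open>This is \<open>Q\<close> along the sequence with \<open>y\<close> and
    \<open>g\<close> exposed, so that choice can extract them for all \<open>n\<close>.\<close>
  define \<Phi> where "\<Phi> n y g \<longleftrightarrow>
    ys (Suc n) = ys n @ [y] \<and> disjoint_parts y \<and> remainder p (ys n) \<le> (SUP x. y x) \<and>
    (\<forall>x. y x \<noteq> bot \<longrightarrow> (\<exists>c. y x \<le> c \<and> (c, g x) \<in> R n)) \<and>
    (\<forall>(c, S)\<in>R (Suc n). \<exists>x. c \<le> y x \<and> child S (g x))" for n y g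
  have "\<exists>y g. \<Phi> n y g" for n
    using st(2)[of n] unfolding Q_def \<Phi>_def ys_def R_def
    by (cases "st n"; cases "st (Suc n)") (simp only: prod.case fst_conv snd_conv)
  then obtain Y g where \<Phi>: "\<And>n. \<Phi> n (Y n) (g n)" by metis
  note Yg = \<Phi>[unfolded \<Phi>_def, THEN conjunct1]
    \<Phi>[unfolded \<Phi>_def, THEN conjunct2, THEN conjunct1]
    \<Phi>[unfolded \<Phi>_def, THEN conjunct2, THEN conjunct2, THEN conjunct1]
    \<Phi>[unfolded \<Phi>_def, THEN conjunct2, THEN conjunct2, THEN conjunct2, THEN conjunct1, rule_format]
    \<Phi>[unfolded \<Phi>_def, THEN conjunct2, THEN conjunct2, THEN conjunct2, THEN conjunct2]
  have ys: "ys n = map Y [0..<n]" for n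
    using len[of 0] by (induction n) (simp_all add: Yg(1))
  have cover: "remainder p (map Y [0..<n]) \<le> (SUP x. Y n x)" for n using Yg(3) ys by simp
  obtain q where q: "q \<noteq> bot" "\<And>n. q \<le> Y n {k. answer p Y (prod_encode (n, k))}"
    using complete_run[OF p Yg(2) cover] by blast
  define x where "x n = {k. answer p Y (prod_encode (n, k))}" for n
  have "child (g (Suc n) (x (Suc n))) (g n (x n))" for n
  proof -
    have q_le: "q \<le> Y m (x m)" for m using q(2) by (simp add: x_def)
    then have "Y (Suc n) (x (Suc n)) \<noteq> bot" using q(1) by (metis bot_unique)
    then obtain c where c: "Y (Suc n) (x (Suc n)) \<le> c" "(c, g (Suc n) (x (Suc n))) \<in> R (Suc n)"
      using Yg(4) by blast
    then obtain x' where x': "c \<le> Y n x'" "child (g (Suc n) (x (Suc n))) (g n x')"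
      using Yg(5) by blast
    \<comment> \<open>The part of \<open>Y n\<close> above \<open>c\<close> contains
      \<open>q\<close>, as does the part named by the answers. Hence the two agree and the selected
      strategies continue one another.\<close>
    have "q \<le> inf (Y n x') (Y n (x n))" using q_le[of n] q_le[of "Suc n"] c(1) x'(1) by simp
    then have "x' = x n" using q(1) Yg(2)[of n] by (metis disjoint_parts_def bot_unique)
    then show ?thesis using x' by simp
  qed
  then show False using no_infinite_descent[of "\<lambda>n. g n (x n)"] by simp
qed

text \<open>As \<open>remainder p []\<close> is \<open>p\<close>, without a surviving reply all
  beaten positions together would form a dense family.\<close>

lemma survives_initial:
  assumes "p \<noteq> bot"
  shows "\<exists>c\<le>p. survives p [] c"
proof (rule ccontr)
  assume "\<not> ?thesis"
  then have "densely_beaten p [] {(c, S). beats p S [] c}"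
    by (auto simp: densely_beaten_def survives_def remainder_def)
  then show False using not_densely_beaten[OF assms] by blast
qed

section \<open>The strategy of II in the descending chain game\<close>

definition first_reply :: "'a \<Rightarrow> 'a"
  where "first_reply p = (SOME c. c \<le> p \<and> survives p [] c)"

definition reply :: "'a \<Rightarrow> (nat set \<Rightarrow> 'a) list \<times> 'a \<Rightarrow> 'a \<Rightarrow> (nat set \<Rightarrow> 'a) list \<times> 'a"
  where "reply p s b = (SOME s'. \<exists>y c. s' = (fst s @ [y], c) \<and>
    legal p (fst s) b y c \<and> survives p (fst s @ [y]) c)"

text \<open>The antichains of II are not moves of the chain game, so the auxiliary position is
  recomputed from the moves of I.\<close>

definition chain_strategy :: "'a list \<Rightarrow> 'a"
  where "chain_strategy bs = snd (foldl (reply (hd bs)) ([], first_reply (hd bs)) (tl bs))"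

lemma chain_strategy_winning: "chain_winning_II chain_strategy"
  unfolding chain_winning_II_def
proof (intro allI impI)
  fix b c :: "nat \<Rightarrow> 'a"
  assume c_strat: "\<forall>n. c n = chain_strategy (map b [0..<Suc n])"
  define p where "p = b 0"
  define s where "s n = foldl (reply p) ([], first_reply p) (map b [1..<Suc n])" for n
  define ys where "ys n = fst (s n)" for n
  have c: "c n = snd (s n)" for n
    using c_strat by (simp add: chain_strategy_def s_def p_def upt_conv_Cons del: upt_Suc)
  have s_0: "s 0 = ([], first_reply p)" by (simp add: s_def)
  have s_Suc: "s (Suc n) = reply p (s n) (b (Suc n))" for n by (simp add: s_def)
  have legal_le: "chain_legal_I b c m" if "chain_legal_I b c n" "m \<le> n" for m n
    using that by (auto simp: chain_legal_I_def)
  have initial: "ys 0 = [] \<and> c 0 \<le> p \<and> survives p (ys 0) (c 0)" if "chain_legal_I b c 0"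
  proof -
    have "p \<noteq> bot" using that by (simp add: chain_legal_I_def p_def)
    then have "\<exists>c. c \<le> p \<and> survives p [] c" by (rule survives_initial)
    then have "first_reply p \<le> p \<and> survives p [] (first_reply p)"
      unfolding first_reply_def by (rule someI_ex)
    then show ?thesis by (simp add: c ys_def s_0)
  qed
  have step: "\<exists>y. ys (Suc n) = ys n @ [y] \<and> legal p (ys n) (b (Suc n)) y (c (Suc n)) \<and>
      survives p (ys (Suc n)) (c (Suc n))"
    if "survives p (ys n) (c n)" "chain_legal_I b c (Suc n)" for n
  proof -
    have b: "b (Suc n) \<noteq> bot" "b (Suc n) \<le> c n" using that(2) by (auto simp: chain_legal_I_def)
    have "\<exists>s' y c'. s' = (fst (s n) @ [y], c') \<and> legal p (fst (s n)) (b (Suc n)) y c' \<and>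
        survives p (fst (s n) @ [y]) c'"
      using survives_step[OF that(1) b] unfolding ys_def by blast
    then have "\<exists>y c'. s (Suc n) = (fst (s n) @ [y], c') \<and>
        legal p (fst (s n)) (b (Suc n)) y c' \<and> survives p (fst (s n) @ [y]) c'"
      unfolding s_Suc reply_def by (rule someI_ex)
    then show ?thesis by (auto simp: c ys_def)
  qed
  have surv: "survives p (ys n) (c n)" if "chain_legal_I b c n" for n
    using that
  proof (induction n)
    case 0
    then show ?case using initial by blast
  next
    case (Suc n)
    then show ?case using step legal_le[of "Suc n" n] by auto
  qed
  show "(\<forall>n. chain_legal_I b c n \<longrightarrow> c n \<noteq> bot \<and> c n \<le> b n) \<and>
    ((\<forall>n. chain_legal_I b c n) \<longrightarrow> (INF n. b n) \<noteq> bot)"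
  proof (intro conjI allI impI)
    fix n assume n: "chain_legal_I b c n"
    show "c n \<noteq> bot" using surv[OF n] by (simp add: survives_def)
    show "c n \<le> b n"
    proof (cases n)
      case 0
      then show ?thesis using initial n by (simp add: p_def)
    next
      case (Suc m)
      then obtain y where "legal p (ys m) (b n) y (c n)"
        using step[of m] surv[of m] legal_le[OF n, of m] n by auto
      then show ?thesis by (auto simp: legal_def)
    qed
  next
    assume all: "\<forall>n. chain_legal_I b c n"
    then obtain Y where Y: "\<And>n. ys (Suc n) = ys n @ [Y n]"
      "\<And>n. legal p (ys n) (b (Suc n)) (Y n) (c (Suc n))"
      using step surv by metis
    have ys_0: "ys 0 = []" using initial all by blast
    have ys: "ys n = map Y [0..<n]" for n
      using ys_0 by (induction n) (simp_all add: Y(1))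
    have p: "p \<noteq> bot" using all by (auto simp: chain_legal_I_def p_def)
    have disj: "disjoint_parts (Y n)" for n using Y(2)[of n] by (simp add: legal_def)
    have cover: "remainder p (map Y [0..<n]) \<le> (SUP x. Y n x)" for n
      using Y(2)[of n] ys by (simp add: legal_def)
    \<comment> \<open>The lower bound for the moves of I comes from the run against
      \<open>\<sigma>\<close> along the antichains that II has added.\<close>
    obtain q where q: "q \<noteq> bot" "\<And>n. q \<le> remainder p (map Y [0..<n])"
      "\<And>n. q \<le> Y n {k. answer p Y (prod_encode (n, k))}"
      using complete_run[OF p disj cover] by blast
    have c_rem: "c (Suc n) \<le> remainder p (map Y [0..<Suc n])" and c_bot: "c (Suc n) \<noteq> bot" for n
      using Y(2)[of n] ys[of "Suc n"] Y(1)[of n] by (simp_all add: legal_def)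
    have "decseq c"
    proof (rule decseq_SucI)
      fix n
      have "c (Suc n) \<le> b (Suc n)" using Y(2)[of n] by (auto simp: legal_def)
      also have "\<dots> \<le> c n" using all by (auto simp: chain_legal_I_def)
      finally show "c (Suc n) \<le> c n" .
    qed
    have "q \<le> b n" for n
    proof (cases n)
      case 0
      then show ?thesis using q(2)[of 0] by (simp add: remainder_def p_def)
    next
      case (Suc m)
      obtain x where x: "c (Suc m) \<le> Y m x" "Y m x \<le> b (Suc m)"
        using Y(2)[of m] by (auto simp: legal_def)
      \<comment> \<open>It remains to see that the part of \<open>Y m\<close> respected by II is the
        one named by the answers, as \<open>q\<close> lies in the latter.\<close>
      have "answer p Y (prod_encode (m, k)) \<longleftrightarrow> k \<in> x" for k
      proof (rule answer_iff_mem[OF disj])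
        \<comment> \<open>This move comes late enough for the cut at bit \<open>k\<close> of
          \<open>Y m\<close> to be counted in the remainder above it, and not before stage
          \<open>Suc m\<close>, so it is still below \<open>Y m x\<close>.\<close>
        let ?c = "c (Suc (prod_encode (m, k)))"
        show "?c \<noteq> bot" by (rule c_bot)
        have "?c \<le> c (Suc m)"
          using \<open>decseq c\<close> le_prod_encode_1[of m k] by (auto dest: decseqD)
        then show "?c \<le> Y m x" using x(1) by order
        show "?c \<le> piece p Y (prod_encode (m, k))"
          using c_rem remainder_le_piece[of _ "Suc (prod_encode (m, k))"] order_trans lessI by metis
      qed
      then have "x = {k. answer p Y (prod_encode (m, k))}" by auto
      then show ?thesis using q(3)[of m] x(2) Suc by simp
    qed
    then have "q \<le> (INF n. b n)" by (intro INF_greatest)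
    then show "(INF n. b n) \<noteq> bot" using q(1) by (metis bot_unique)
  qed
qed

end

theorem theorem2:
  assumes "continuum_plus_cc TYPE('a::{boolean_algebra,complete_lattice})"
    and "\<exists>\<sigma> :: 'a \<Rightarrow> 'a list \<Rightarrow> bool. cut_choose_winning_II \<sigma>"
  shows "\<exists>\<tau> :: 'a list \<Rightarrow> 'a. chain_winning_II \<tau>"
proof -
  obtain \<sigma> :: "'a \<Rightarrow> 'a list \<Rightarrow> bool" where "cut_choose_winning_II \<sigma>" using assms(2) by blast
  then interpret cut_choose_strategy \<sigma> using assms(1) by unfold_locales
  show ?thesis using chain_strategy_winning by blast
qed

end
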